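(* Let $\mathsf{M}$ be a loopless matroid of rank two on $n$ elements having $s$ hyperplanes, with cardinalities $h_1,\ldots, h_s$. Then for every $i\ge 0$ the number of $i$-dimensional faces of $\mathscr{P}(\mathsf{M})$ or, equivalently, of the edge polytope of a complete multipartite graph with parts of sizes $h_1,\ldots,h_s$, is given by $$f_i(\mathscr{P}(\mathsf{M})) = \binom{n+1}{i+2}+(s-1)\binom{n}{i+2} - \sum_{1\le j<\ell\le s} \binom{h_j+h_\ell+1}{i+2} + (s-2)\sum_{j=1}^s \binom{h_j+1}{i+2} - \sum_{j=1}^s \binom{n-h_j}{i+2}.$$
   Context: The base polytope $\mathscr{P}(\mathsf{M})$ of a matroid $\mathsf{M}$ is the convex hull of the indicator vectors of its bases; $f_i(\mathscr{P})$ denotes the number of $i$-dimensional faces of $\mathscr{P}$ (the polytope itself counts as a face). The hyperplanes of a rank two matroid are its flats of rank one; for a loopless rank two matroid they partition the ground set (so $n=h_1+\cdots+h_s$), and the bases are the pairs of elements lying in different parts. The edge polytope of a graph on vertex set $[n]$ is the convex hull of the vectors $e_u+e_v$ over all edges $\{u,v\}$. *)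

theory Defs
  imports "HOL-Analysis.Analysis"
begin

locale matroid =
  fixes E :: "'a set" and I :: "'a set set"
  assumes finite_ground: "finite E"
    and indep_subset_ground: "X \<in> I \<Longrightarrow> X \<subseteq> E"
    and empty_indep: "{} \<in> I"
    and indep_downward: "X \<in> I \<Longrightarrow> Y \<subseteq> X \<Longrightarrow> Y \<in> I"
    and augmentation:
      "X \<in> I \<Longrightarrow> Y \<in> I \<Longrightarrow> card X < card Y \<Longrightarrow> \<exists>y \<in> Y - X. insert y X \<in> I"

definition matroid_bases :: "'a set set \<Rightarrow> 'a set set" where
  "matroid_bases I = {B \<in> I. \<forall>J \<in> I. B \<subseteq> J \<longrightarrow> J = B}"

definition matroid_rank :: "'a set set \<Rightarrow> 'a set \<Rightarrow> nat" where
  "matroid_rank I X = Max {card J | J. J \<in> I \<and> J \<subseteq> X}"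

definition loopless :: "'a set \<Rightarrow> 'a set set \<Rightarrow> bool" where
  "loopless E I \<longleftrightarrow> (\<forall>x \<in> E. {x} \<in> I)"

definition matroid_flat :: "'a set \<Rightarrow> 'a set set \<Rightarrow> 'a set \<Rightarrow> bool" where
  "matroid_flat E I F \<longleftrightarrow>
     F \<subseteq> E \<and> (\<forall>x \<in> E - F. matroid_rank I F < matroid_rank I (insert x F))"

definition matroid_hyperplanes :: "'a set \<Rightarrow> 'a set set \<Rightarrow> 'a set set" where
  "matroid_hyperplanes E I =
     {F. matroid_flat E I F \<and> matroid_rank I F + 1 = matroid_rank I E}"

text \<open>The ground set may be a proper subset of the finite index type; the polytope
  then lies in the coordinate subspace of vectors vanishing outside the ground set.
  The same applies to the vertex set of a graph below.\<close>

definition base_polytope :: "'a set set \<Rightarrow> (real ^ 'a::finite) set" where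
  "base_polytope I = convex hull ((\<lambda>B. \<chi> x. indicator B x) ` matroid_bases I)"

definition edge_polytope :: "'a set set \<Rightarrow> (real ^ 'a::finite) set" where
  "edge_polytope D = convex hull {axis u 1 + axis v 1 | u v. u \<noteq> v \<and> {u, v} \<in> D}"

text \<open>The simple graph with vertex set \<open>V\<close> and edge set \<open>D\<close> (a set of two-element sets)
  is complete multipartite with parts \<open>P j\<close>, \<open>j \<in> J\<close>.\<close>

definition complete_multipartite ::
    "'a set \<Rightarrow> 'a set set \<Rightarrow> 'i set \<Rightarrow> ('i \<Rightarrow> 'a set) \<Rightarrow> bool" where
  "complete_multipartite V D J P \<longleftrightarrow>
     disjoint_family_on P J \<and> V = (\<Union>j\<in>J. P j) \<and>
     D = {{u, v} | u v. \<exists>j \<in> J. \<exists>l \<in> J. j \<noteq> l \<and> u \<in> P j \<and> v \<in> P l}"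

text \<open>Since \<open>aff_dim {} = -1\<close>, the empty face is never counted; the polytope itself is.\<close>

definition num_faces :: "'a::euclidean_space set \<Rightarrow> nat \<Rightarrow> nat" where
  "num_faces P i = card {F. F face_of P \<and> aff_dim F = int i}"

definition rank_two_face_number :: "nat \<Rightarrow> nat \<Rightarrow> (nat \<Rightarrow> nat) \<Rightarrow> nat \<Rightarrow> int" where
  "rank_two_face_number n s h i =
     int ((n + 1) choose (i + 2)) + (int s - 1) * int (n choose (i + 2))
     - (\<Sum>(j, l) \<in> {(j, l). 1 \<le> j \<and> j < l \<and> l \<le> s}. int ((h j + h l + 1) choose (i + 2)))
     + (int s - 2) * (\<Sum>j = 1..s. int ((h j + 1) choose (i + 2)))
     - (\<Sum>j = 1..s. int ((n - h j) choose (i + 2)))"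

end

(* For parts P_j, the polytope is the set of nonnegative vectors of coordinate sum 2 whose
   weight on each part is at most 1. A nonempty face is determined by any point x of its relative
   interior, through the support S of x and the set T of parts on which x has weight 1. With t the
   number of parts met by S, the pairs that occur are: T empty and t >= 3, giving dimension
   |S| - 1; T = {j} with j met and t >= 3; and t = 2 with T both parts met, giving dimension
   |S| - 2. They are counted with the identities (for S nonempty, sums over all pairs j < l
   and all parts j)
     [t >= 3] = 1 - sum [S <= P_j u P_l] + (s - 2) sum [S <= P_j],
     t [t >= 3] + [t = 2] = s - sum [S <= V - P_j] + (s - 2) sum [S <= P_j]
       - sum [S <= P_j u P_l].
   The face description also shows that the vertices are the vectors e_u + e_v with u and v in
   different parts. In a loopless matroid of rank two the hyperplanes are the parallel classes. *)

theory Submission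
  imports Defs
begin

section \<open>Faces of the polytope of a partition\<close>

definition weight :: "real ^ 'a::finite \<Rightarrow> 'a set \<Rightarrow> real" where
  "weight x A = (\<Sum>v\<in>A. x $ v)"

definition supp :: "real ^ 'a::finite \<Rightarrow> 'a set" where
  "supp x = {v. x $ v \<noteq> 0}"

lemma weight_eq_inner: "weight x A = (\<chi> v. indicator A v) \<bullet> x"
  by (simp add: weight_def inner_vec_def indicator_def if_distrib[of "\<lambda>c. c * _"] sum.If_cases)

lemma weight_linear [simp]:
  "weight (x + y) A = weight x A + weight y A"
  "weight (c *\<^sub>R x) A = c * weight x A"
  by (simp_all add: weight_def sum.distrib sum_distrib_left)

lemma axis_nth_other: "v \<noteq> u \<Longrightarrow> axis u c $ v = 0"
  by (simp add: axis_def)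

lemma axis_nth_nonneg: "0 \<le> (axis u 1 :: real ^ 'a::finite) $ v"
  by (simp add: axis_def)

lemma weight_axis: "weight (axis u 1) A = (if u \<in> A then 1 else 0)"
  by (simp add: weight_def axis_def)

text \<open>Parts may be empty. The linear order on the indices allows each unordered pair of parts
  to be listed exactly once, as \<open>j < l\<close>.\<close>

locale partition =
  fixes J :: "'i::linorder set" and P :: "'i \<Rightarrow> 'a::finite set"
  assumes finite_index: "finite J" and disjoint_parts: "disjoint_family_on P J"
begin

definition V :: "'a set" where "V = (\<Union>j\<in>J. P j)"

definition hits :: "'a set \<Rightarrow> 'i set" where
  "hits S = {j \<in> J. S \<inter> P j \<noteq> {}}"

definition tight :: "real ^ 'a \<Rightarrow> 'i set" where
  "tight x = {j \<in> J. weight x (P j) = 1}"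

text \<open>Only the equations are collected here. For the pairs realised by points of
  \<open>Q\<close> this is the affine hull of \<open>face S T\<close>, from which the dimension is
  read off.\<close>

definition plane :: "'a set \<Rightarrow> 'i set \<Rightarrow> (real ^ 'a) set" where
  "plane S T = {y. (\<forall>v. v \<notin> S \<longrightarrow> y $ v = 0) \<and> weight y UNIV = 2 \<and> (\<forall>j\<in>T. weight y (P j) = 1)}"

definition face :: "'a set \<Rightarrow> 'i set \<Rightarrow> (real ^ 'a) set" where
  "face S T = {y \<in> plane S T. (\<forall>v. 0 \<le> y $ v) \<and> (\<forall>j\<in>J. weight y (P j) \<le> 1)}"

abbreviation "Q \<equiv> face V {}"

text \<open>The pairs of support and set of tight parts realised by points of \<open>Q\<close>. If only two
  parts are hit, both carry weight 1; if at least three are hit, two tight parts would use up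
  the total weight 2.\<close>

definition types :: "('a set \<times> 'i set) set" where
  "types = {(S, T). S \<subseteq> V \<and>
     (T = {} \<and> 3 \<le> card (hits S) \<or> (\<exists>j\<in>hits S. T = {j} \<and> 3 \<le> card (hits S)) \<or>
      T = hits S \<and> card (hits S) = 2)}"

section \<open>Faces cut out by tight inequalities, and their relative interiors\<close>

lemma finite_hits [simp]: "finite (hits S)"
  using finite_index by (simp add: hits_def)

text \<open>The parts split \<open>V\<close>, and a part disjoint from \<open>S\<close> contributes
  0.\<close>

lemma weight_hits:
  assumes "\<And>v. v \<notin> S \<Longrightarrow> y $ v = 0" "S \<subseteq> V"
  shows "(\<Sum>j\<in>hits S. weight y (P j)) = weight y UNIV"
proof -
  have "weight y UNIV = weight y V"
    unfolding weight_def using assms by (intro sum.mono_neutral_right) auto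
  also have "\<dots> = (\<Sum>j\<in>J. weight y (P j))"
    unfolding weight_def V_def using disjoint_parts finite_index
    by (intro sum.UNION_disjoint) (auto simp: disjoint_family_on_def)
  also have "\<dots> = (\<Sum>j\<in>hits S. weight y (P j))"
  proof (rule sum.mono_neutral_right)
    show "\<forall>j\<in>J - hits S. weight y (P j) = 0"
      unfolding weight_def using assms by (auto simp: hits_def intro!: sum.neutral)
  qed (auto simp: hits_def finite_index)
  finally show ?thesis by simp
qed

lemma affine_plane: "affine (plane S T)"
  unfolding affine_def plane_def by (auto simp: algebra_simps simp flip: distrib_right)

lemma convex_face: "convex (face S T)"
proof -
  have "convex (plane S T)" by (rule affine_imp_convex[OF affine_plane])
  then show ?thesis
    unfolding face_def convex_def by (auto simp: convex_bound_le)
qed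

text \<open>The additional equations turn inequalities valid on \<open>Q\<close> into equalities. If
  a proper convex combination of two points of \<open>Q\<close> attains equality in such an
  inequality, so do both points.\<close>

lemma face_of_Q:
  assumes "S \<subseteq> V" "T \<subseteq> J"
  shows "face S T face_of Q"
  unfolding face_of_def
proof (intro conjI ballI impI)
  show "face S T \<subseteq> Q" using assms by (auto simp: face_def plane_def)
  show "convex (face S T)" by (rule convex_face)
next
  \<comment> \<open>Proved for one endpoint only; the other follows by exchanging \<open>a\<close>
    with \<open>b\<close> and \<open>u\<close> with \<open>1 - u\<close>.\<close>
  have main: "a \<in> face S T"
    if a: "a \<in> Q" and b: "b \<in> Q" and x: "x \<in> face S T"
      and u: "0 < u" "u < 1" "x = u *\<^sub>R a + (1 - u) *\<^sub>R b" for a b x u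
  proof -
    have "a $ v = 0" if "v \<notin> S" for v
    proof -
      have "u * a $ v + (1 - u) * b $ v = 0" "0 \<le> a $ v" "0 \<le> b $ v"
        using that x u a b by (auto simp: face_def plane_def)
      then show ?thesis using u(1,2)
        by (smt (verit) mult_nonneg_nonneg mult_pos_pos)
    qed
    moreover have "weight a (P j) = 1" if "j \<in> T" for j
    proof -
      have *: "u * weight a (P j) + (1 - u) * weight b (P j) = 1"
          "weight a (P j) \<le> 1" "weight b (P j) \<le> 1"
        using that x u a b assms by (auto simp: face_def plane_def)
      have "(1 - u) * weight b (P j) \<le> 1 - u"
        using *(3) u by (simp add: mult_left_le)
      then have "u * 1 \<le> u * weight a (P j)" using *(1) by simp
      then show ?thesis using *(2) u(1) by (simp add: mult_le_cancel_left)
    qed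
    ultimately show ?thesis using a by (auto simp: face_def plane_def)
  qed
  fix a b x assume ab: "a \<in> Q" "b \<in> Q" and x: "x \<in> face S T" "x \<in> open_segment a b"
  then obtain u where u: "0 < u" "u < 1" "x = (1 - u) *\<^sub>R a + u *\<^sub>R b"
    by (auto simp: in_segment)
  show "a \<in> face S T" using main[OF ab x(1), of "1 - u"] u by simp
  show "b \<in> face S T" using main[OF ab(2,1) x(1), of u] u by (simp add: add.commute)
qed

lemma supp_tight_mem:
  assumes "x \<in> Q"
  shows "supp x \<subseteq> V" "tight x \<subseteq> J" "x \<in> face (supp x) (tight x)"
  using assms by (auto simp: face_def plane_def supp_def tight_def)

text \<open>Every inequality not forced to equality on the plane is strict at \<open>x\<close>, so a
  whole neighbourhood of \<open>x\<close> within the plane stays in the face.\<close>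

lemma rel_interior_face:
  assumes x: "x \<in> Q"
  defines "F \<equiv> face (supp x) (tight x)" and "L \<equiv> plane (supp x) (tight x)"
  shows "affine hull F = L" "x \<in> rel_interior F"
proof -
  \<comment> \<open>The open region where all inequalities that are strict at \<open>x\<close>
    remain strict.\<close>
  define U where "U = (\<Inter>v\<in>supp x. {y. 0 < y $ v}) \<inter> (\<Inter>j\<in>J - tight x. {y. weight y (P j) < 1})"
  have "open U"
    unfolding U_def weight_def using finite_index
    by (intro open_Int open_INT ballI finite open_Collect_less continuous_intros) auto
  have xU: "x \<in> U" using x
    by (auto simp: U_def supp_def tight_def face_def plane_def less_le)
  have xF: "x \<in> F" using supp_tight_mem[OF x] by (simp add: F_def)
  have FL: "F \<subseteq> L" by (auto simp: F_def L_def face_def)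
  have LU: "L \<inter> U \<subseteq> F"
  proof
    fix y assume "y \<in> L \<inter> U"
    then have y: "y \<in> L" "\<And>v. v \<in> supp x \<Longrightarrow> 0 < y $ v"
      "\<And>j. j \<in> J - tight x \<Longrightarrow> weight y (P j) < 1" by (auto simp: U_def)
    have "0 \<le> y $ v" for v
      using y(1) y(2)[of v] by (cases "v \<in> supp x") (auto simp: L_def plane_def)
    moreover have "weight y (P j) \<le> 1" if "j \<in> J" for j
      using y(1) y(3)[of j] that by (cases "j \<in> tight x") (auto simp: L_def plane_def)
    ultimately show "y \<in> F" using y(1) by (auto simp: F_def L_def face_def)
  qed
  have affL: "affine L" by (simp add: L_def affine_plane)
  have "affine hull (L \<inter> U) = affine hull L"
    using affL \<open>open U\<close> xU xF FL by (intro affine_hull_affine_Int_open) auto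
  then show hull: "affine hull F = L"
    using hull_mono[OF LU, of affine] hull_mono[OF FL, of affine] affL
    by (metis affine_hull_eq subset_antisym)
  show "x \<in> rel_interior F"
    unfolding mem_rel_interior hull using \<open>open U\<close> xU xF LU by blast
qed

text \<open>A nonempty face has a relative interior point \<open>x\<close>. This \<open>x\<close> is
  also relatively interior to \<open>face (supp x) (tight x)\<close>, and two faces whose relative
  interiors meet are equal.\<close>

lemma faces_of_Q:
  assumes "F face_of Q" "F \<noteq> {}"
  shows "\<exists>x\<in>Q. F = face (supp x) (tight x)"
proof -
  obtain x where x: "x \<in> rel_interior F"
    using assms face_of_imp_convex rel_interior_eq_empty by blast
  then have xQ: "x \<in> Q" using assms(1) face_of_imp_subset rel_interior_subset by blast
  have "F = face (supp x) (tight x)"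
    using face_of_eq[OF assms(1) face_of_Q[OF supp_tight_mem(1,2)[OF xQ]]] x
      rel_interior_face(2)[OF xQ] by blast
  with xQ show ?thesis by blast
qed

text \<open>Since \<open>x\<close> lies in the face of \<open>y\<close>, it satisfies the equations
  of that face, which gives one inclusion for the supports and the opposite one for the tight sets.
  Symmetry gives the rest.\<close>

lemma face_inject:
  assumes "x \<in> Q" "y \<in> Q" "face (supp x) (tight x) = face (supp y) (tight y)"
  shows "supp x = supp y" "tight x = tight y"
proof -
  have *: "supp x \<subseteq> supp y \<and> tight y \<subseteq> tight x"
    if "x \<in> Q" "y \<in> Q" "face (supp x) (tight x) = face (supp y) (tight y)" for x y
  proof -
    have "x \<in> face (supp y) (tight y)" using supp_tight_mem(3)[OF that(1)] that(3) by simp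
    then show ?thesis using supp_tight_mem(2)[OF that(2)]
      by (auto simp: face_def plane_def supp_def tight_def)
  qed
  show "supp x = supp y" "tight x = tight y"
    using *[of x y] *[of y x] assms by auto
qed

lemma type_of_point:
  assumes x: "x \<in> Q"
  shows "(supp x, tight x) \<in> types"
proof -
  define S where "S = supp x"
  define w where "w j = weight x (P j)" for j
  have SV: "S \<subseteq> V" using supp_tight_mem[OF x] by (simp add: S_def)
  have sum2: "sum w (hits S) = 2"
    using weight_hits[OF _ SV, of x] x by (auto simp: w_def S_def supp_def face_def plane_def)
  have w1: "w j \<le> 1" if "j \<in> hits S" for j
    using that x by (auto simp: w_def hits_def face_def)
  have w0: "0 < w j" if j: "j \<in> hits S" for j
  proof -
    obtain v where "v \<in> P j" "x $ v \<noteq> 0" using j by (auto simp: hits_def S_def supp_def)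
    moreover have "0 \<le> x $ u" for u using x by (auto simp: face_def)
    ultimately show ?thesis unfolding w_def weight_def by (intro sum_pos2[of _ v]) (auto simp: less_le)
  qed
  have tight: "tight x = {j \<in> hits S. w j = 1}"
  proof -
    have "j \<in> hits S" if "weight x (P j) = 1" "j \<in> J" for j
    proof (rule ccontr)
      assume "j \<notin> hits S"
      then have "weight x (P j) = 0" using that
        unfolding weight_def by (intro sum.neutral) (auto simp: hits_def S_def supp_def)
      with that show False by simp
    qed
    then show ?thesis by (auto simp: tight_def w_def hits_def)
  qed
  have card2: "2 \<le> card (hits S)"
  proof -
    \<comment> \<open>Each hit part carries at most 1 of the total weight 2.\<close>
    have "sum w (hits S) \<le> (\<Sum>j\<in>hits S. 1)" by (intro sum_mono w1)
    then show ?thesis using sum2 by simp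
  qed
  show ?thesis
  proof (cases "card (hits S) = 2")
    case True
    have "w j = 1" if j: "j \<in> hits S" for j
    proof -
      obtain a b where ab: "hits S = {a, b}" "a \<noteq> b" using True card_2_iff by metis
      then show ?thesis using w1[of a] w1[of b] sum2 j by auto
    qed
    then have "tight x = hits S" by (auto simp: tight)
    then show ?thesis using True SV by (auto simp: types_def S_def)
  next
    case False
    then have c3: "3 \<le> card (hits S)" using card2 by simp
    have "a = b" if ab: "a \<in> tight x" "b \<in> tight x" for a b
    proof (rule ccontr)
      assume neq: "a \<noteq> b"
      have "\<not> hits S \<subseteq> {a, b}" using card_mono[of "{a, b}" "hits S"] c3 neq by auto
      then obtain c where c: "c \<in> hits S" "c \<notin> {a, b}" by auto
      have "sum w {a, b, c} \<le> sum w (hits S)"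
        using c ab by (intro sum_mono2) (auto simp: tight intro: less_imp_le[OF w0])
      moreover have "sum w {a, b, c} = 2 + w c" using c ab neq by (auto simp: tight)
      ultimately show False using w0[OF c(1)] sum2 by simp
    qed
    then have "tight x = {} \<or> (\<exists>j\<in>hits S. tight x = {j})" using tight by blast
    then show ?thesis using c3 SV by (auto simp: types_def S_def)
  qed
qed

section \<open>Realising every admissible type by a point\<close>

lemma part_unique: "j \<in> J \<Longrightarrow> l \<in> J \<Longrightarrow> v \<in> P j \<Longrightarrow> v \<in> P l \<Longrightarrow> j = l"
  using disjoint_parts by (auto simp: disjoint_family_on_def)

text \<open>The prescribed weight of each hit part is spread evenly over the elements of
  \<open>S\<close> in that part.\<close>

lemma point_with_weights:
  assumes S: "S \<subseteq> V" and w: "\<And>j. j \<in> hits S \<Longrightarrow> 0 < w j \<and> w j \<le> 1" "sum w (hits S) = (2::real)"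
  shows "\<exists>x\<in>Q. supp x = S \<and> tight x = {j \<in> hits S. w j = 1}"
proof -
  \<comment> \<open>The index of the part containing \<open>v\<close>, meaningful for
    \<open>v\<close> in \<open>V\<close>.\<close>
  define p where "p v = (THE j. j \<in> J \<and> v \<in> P j)" for v
  have p: "p v = j" if "j \<in> J" "v \<in> P j" for v j
    unfolding p_def using that part_unique by blast
  define x :: "real ^ 'a" where
    "x = (\<chi> v. if v \<in> S then w (p v) / card (S \<inter> P (p v)) else 0)"
  have wx: "weight x (P j) = (if j \<in> hits S then w j else 0)" if j: "j \<in> J" for j
  proof -
    have "weight x (P j) = (\<Sum>v\<in>S \<inter> P j. x $ v)"
      unfolding weight_def by (rule sum.mono_neutral_right) (auto simp: x_def)
    also have "\<dots> = (\<Sum>v\<in>S \<inter> P j. w j / card (S \<inter> P j))"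
      using j by (intro sum.cong) (auto simp: x_def p)
    also have "\<dots> = (if j \<in> hits S then w j else 0)"
      using j by (auto simp: hits_def)
    finally show ?thesis .
  qed
  have pos: "0 < x $ v" if v: "v \<in> S" for v
  proof -
    obtain j where j: "j \<in> J" "v \<in> P j" using v S by (auto simp: V_def)
    then have "j \<in> hits S" using v by (auto simp: hits_def)
    moreover have "0 < card (S \<inter> P j)" using v j by (auto simp: card_gt_0_iff)
    ultimately show ?thesis using w(1)[of j] v j by (simp add: x_def p)
  qed
  have zero: "x $ v = 0" if "v \<notin> S" for v using that by (simp add: x_def)
  have "supp x = S" using pos zero by (force simp: supp_def)
  moreover have "tight x = {j \<in> hits S. w j = 1}"
    by (auto simp: tight_def wx hits_def split: if_splits)
  moreover have "x \<in> Q"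
  proof -
    have "weight x UNIV = 2"
      using weight_hits[OF zero S] w(2) by (simp add: wx hits_def)
    moreover have "0 \<le> x $ v" for v using pos zero by (cases "v \<in> S") (auto intro: less_imp_le)
    moreover have "\<forall>j\<in>J. weight x (P j) \<le> 1" using w(1) by (auto simp: wx)
    ultimately show ?thesis using zero S by (auto simp: face_def plane_def)
  qed
  ultimately show ?thesis by blast
qed

lemma point_of_type:
  assumes "(S, T) \<in> types"
  shows "\<exists>x\<in>Q. supp x = S \<and> tight x = T"
proof -
  have S: "S \<subseteq> V" using assms by (simp add: types_def)
  define k where "k = real (card (hits S))"
  consider "T = {}" "3 \<le> k" | j where "j \<in> hits S" "T = {j}" "3 \<le> k"
    | "T = hits S" "k = 2"
    using assms by (auto simp: types_def k_def)
  then obtain w where w: "\<And>j. j \<in> hits S \<Longrightarrow> 0 < w j \<and> w j \<le> 1" "sum w (hits S) = (2::real)"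
    "T = {j \<in> hits S. w j = 1}"
  proof cases
    case 1
    \<comment> \<open>Equal shares of the total 2 are below 1 because \<open>3 \<le> k\<close>, so
      no part is tight.\<close>
    then show ?thesis by (intro that[of "\<lambda>_. 2 / k"]) (auto simp: k_def)
  next
    case (2 j)
    \<comment> \<open>Part \<open>j\<close> takes weight 1 and the other \<open>k - 1\<close> parts
      share the remaining 1 equally; as \<open>3 \<le> k\<close>, each of these shares is below
      1.\<close>
    have "(\<Sum>i\<in>hits S - {j}. if i = j then 1 else 1 / (k - 1)) = (\<Sum>i\<in>hits S - {j}. 1 / (k - 1))"
      by (rule sum.cong) auto
    also have "\<dots> = 1" using 2 by (auto simp: k_def card_Diff_singleton of_nat_diff)
    finally show ?thesis using 2
      by (intro that[of "\<lambda>i. if i = j then 1 else 1 / (k - 1)"])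
         (auto simp: sum.remove[OF _ 2(1)])
  next
    case 3
    then show ?thesis by (intro that[of "\<lambda>_. 1"]) (auto simp: k_def)
  qed
  then show ?thesis using point_with_weights[OF S w(1,2)] by simp
qed

lemma types_eq: "types = (\<lambda>x. (supp x, tight x)) ` Q"
  using type_of_point point_of_type by (auto simp: image_iff) metis

section \<open>Dimensions of the faces and the face count by types\<close>

lemma dim_coordinate_subspace: "aff_dim {y::real^'a. \<forall>v. v \<notin> S \<longrightarrow> y $ v = 0} = int (card S)"
proof -
  have "subspace {y::real^'a. \<forall>v. v \<notin> S \<longrightarrow> y $ v = 0}" by (auto simp: subspace_def)
  moreover have "dim {y::real^'a. \<forall>v. v \<notin> S \<longrightarrow> y $ v = 0} = card S"
    using dim_substandard_cart[of S, where 'a = real] by (simp only: dim_vec_eq)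
  ultimately show ?thesis by (simp add: aff_dim_subspace)
qed

text \<open>Starting from the coordinate subspace of dimension \<open>card S\<close>, the total
  weight equation lowers the dimension by one, and the first tight part lowers it by one more. If
  both of two hit parts are tight, the second equation follows from the first and the total.\<close>

lemma aff_dim_plane:
  assumes "(S, T) \<in> types"
  shows "aff_dim (plane S T) = (if T = {} then int (card S) - 1 else int (card S) - 2)"
proof -
  have S: "S \<subseteq> V" using assms by (simp add: types_def)
  obtain x where x: "x \<in> Q" "supp x = S" "tight x = T" using point_of_type[OF assms] by blast
  then have xL: "x \<in> plane S T" using supp_tight_mem by (auto simp: face_def)
  define L0 where "L0 = {y::real^'a. \<forall>v. v \<notin> S \<longrightarrow> y $ v = 0}"
  have aff0: "affine L0" by (auto simp: L0_def affine_def)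
  have L1: "plane S {} = L0 \<inter> {y. (\<chi> v. indicator UNIV v) \<bullet> y = 2}"
    unfolding weight_eq_inner[symmetric] by (auto simp: plane_def L0_def)
  \<comment> \<open>The origin shows that the hyperplane does not contain the subspace, and
    \<open>x\<close> shows that the two meet; together they make the drop exactly one.\<close>
  have "0 \<in> L0 - {y. (\<chi> v. indicator UNIV v) \<bullet> y = 2}" by (simp add: L0_def)
  moreover have "x \<in> plane S {}" using xL by (auto simp: plane_def)
  ultimately have dim1: "aff_dim (plane S {}) = int (card S) - 1"
    unfolding L1 using aff_dim_affine_Int_hyperplane[OF aff0] dim_coordinate_subspace[of S]
    by (auto simp: L0_def[symmetric])
  have dim2: "aff_dim (plane S {j}) = int (card S) - 2"
    if j: "j \<in> hits S" "x \<in> plane S {j}" "2 \<le> card (hits S)" for j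
  proof -
    have L2: "plane S {j} = plane S {} \<inter> {y. (\<chi> v. indicator (P j) v) \<bullet> y = 1}"
      unfolding weight_eq_inner[symmetric] by (auto simp: plane_def)
    have "\<not> hits S \<subseteq> {j}" using j(3) card_mono[of "{j}" "hits S"] by auto
    then obtain l v where l: "l \<in> J" "l \<noteq> j" "v \<in> S" "v \<in> P l" by (auto simp: hits_def)
    then have "v \<notin> P j" using j(1) part_unique by (auto simp: hits_def)
    \<comment> \<open>All the weight is put on an element of another hit part, so the total is 2
      while the weight of \<open>P j\<close> is 0.\<close>
    then have "2 *\<^sub>R axis v 1 \<in> plane S {} - {y. (\<chi> v. indicator (P j) v) \<bullet> y = 1}"
      unfolding weight_eq_inner[symmetric] using l by (auto simp: plane_def weight_axis intro!: axis_nth_other)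
    then show ?thesis using j(2) dim1
      unfolding L2 by (subst aff_dim_affine_Int_hyperplane[OF affine_plane]) auto
  qed
  consider "T = {}" | j where "j \<in> hits S" "T = {j}" "3 \<le> card (hits S)"
    | "T = hits S" "card (hits S) = 2"
    using assms by (auto simp: types_def)
  then show ?thesis
  proof cases
    case 1
    then show ?thesis using dim1 by simp
  next
    case (2 j)
    then show ?thesis using dim2[of j] xL by simp
  next
    case 3
    obtain a b where ab: "hits S = {a, b}" "a \<noteq> b" using 3(2) card_2_iff by metis
    \<comment> \<open>With only two parts hit, weight 1 on one leaves exactly 1 for the
      other.\<close>
    have "plane S {a} = plane S T"
    proof -
      have "weight y (P b) = 1" if "y \<in> plane S {a}" for y
        using weight_hits[OF _ S, of y] that ab by (auto simp: plane_def)
      then show ?thesis using 3 ab by (auto simp: plane_def)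
    qed
    then show ?thesis using dim2[of a] xL 3 ab by auto
  qed
qed

lemma aff_dim_face:
  assumes "x \<in> Q"
  shows "aff_dim (face (supp x) (tight x)) =
    (if tight x = {} then int (card (supp x)) - 1 else int (card (supp x)) - 2)"
  using rel_interior_face(1)[OF assms] aff_dim_plane[OF type_of_point[OF assms]]
  by (metis aff_dim_affine_hull)

text \<open>Types correspond bijectively to nonempty faces, and the condition on
  \<open>card S\<close> is the dimension formula solved for \<open>card S\<close>.\<close>

lemma num_faces_Q:
  "num_faces Q i = card {(S, T) \<in> types. card S = (if T = {} then i + 1 else i + 2)}"
proof -
  let ?A = "{(S, T) \<in> types. card S = (if T = {} then i + 1 else i + 2)}"
  have "bij_betw (\<lambda>(S, T). face S T) ?A {F. F face_of Q \<and> aff_dim F = int i}"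
    unfolding bij_betw_def
  proof (intro conjI subset_antisym)
    show "inj_on (\<lambda>(S, T). face S T) ?A"
    proof (rule inj_onI)
      fix A B assume "A \<in> ?A" "B \<in> ?A" and eq: "(case A of (S, T) \<Rightarrow> face S T) = (case B of (S, T) \<Rightarrow> face S T)"
      then obtain x y where "x \<in> Q" "A = (supp x, tight x)" "y \<in> Q" "B = (supp y, tight y)"
        by (auto simp: types_eq)
      then show "A = B" using face_inject[of x y] eq by simp
    qed
    show "(\<lambda>(S, T). face S T) ` ?A \<subseteq> {F. F face_of Q \<and> aff_dim F = int i}"
    proof clarify
      fix S T assume ST: "(S, T) \<in> types" "card S = (if T = {} then i + 1 else i + 2)"
      then obtain x where "x \<in> Q" "supp x = S" "tight x = T" by (auto simp: types_eq)
      then show "face S T face_of Q \<and> aff_dim (face S T) = int i"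
        using ST(2) face_of_Q supp_tight_mem(1,2)[of x] aff_dim_face[of x] by (auto split: if_splits)
    qed
    show "{F. F face_of Q \<and> aff_dim F = int i} \<subseteq> (\<lambda>(S, T). face S T) ` ?A"
    proof
      fix F assume F: "F \<in> {F. F face_of Q \<and> aff_dim F = int i}"
      \<comment> \<open>The empty face has dimension -1, whereas \<open>int i\<close> is
        nonnegative.\<close>
      then have "F \<noteq> {}" by auto
      with F obtain x where x: "x \<in> Q" "F = face (supp x) (tight x)" using faces_of_Q by blast
      with F have "(supp x, tight x) \<in> ?A"
        by (auto simp: aff_dim_face type_of_point split: if_splits)
      then show "F \<in> (\<lambda>(S, T). face S T) ` ?A" using x(2) by force
    qed
  qed
  from bij_betw_same_card[OF this] show ?thesis unfolding num_faces_def by (rule sym)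
qed

section \<open>The vertices of the polytope\<close>

lemma compact_Q: "compact Q"
proof -
  have eq: "Q = (\<Inter>v\<in>-V. {y. y $ v = 0}) \<inter> {y. weight y UNIV = 2} \<inter> (\<Inter>v. {y. 0 \<le> y $ v}) \<inter>
      (\<Inter>j\<in>J. {y. weight y (P j) \<le> 1})"
    by (auto simp: face_def plane_def)
  have "closed Q"
    unfolding eq weight_def
    by (intro closed_Int closed_INT ballI closed_Collect_eq closed_Collect_le continuous_intros)
  moreover have "bounded Q"
  proof (rule boundedI)
    fix y assume y: "y \<in> Q"
    \<comment> \<open>The coordinates are nonnegative, so the sum of absolute values is the total
      weight.\<close>
    then have "(\<Sum>v\<in>UNIV. \<bar>y $ v\<bar>) = 2" by (auto simp: face_def plane_def weight_def)
    then show "norm y \<le> 2" using norm_le_l1_cart[of y] by simp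
  qed
  ultimately show ?thesis by (simp add: compact_eq_bounded_closed)
qed

text \<open>The generators lie in \<open>Q\<close> because no part contains both \<open>u\<close>
  and \<open>v\<close>. Conversely, an extreme point is a zero-dimensional face, whose type leaves
  only a generator, and a compact convex set is the hull of its extreme points.\<close>

lemma Q_eq_hull:
  "Q = convex hull {axis u 1 + axis v 1 | u v. \<exists>j\<in>J. \<exists>l\<in>J. j \<noteq> l \<and> u \<in> P j \<and> v \<in> P l}"
    (is "_ = convex hull ?W")
proof
  have "?W \<subseteq> Q"
  proof clarify
    fix u v j l assume "j \<in> J" "l \<in> J" "j \<noteq> l" "u \<in> P j" "v \<in> P l"
    moreover from this have "\<not> (u \<in> P i \<and> v \<in> P i)" if "i \<in> J" for i
      using that part_unique by metis
    moreover have "w \<noteq> u" "w \<noteq> v" if "w \<notin> V" for w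
      using that calculation(1-5) by (auto simp: V_def)
    ultimately show "axis u 1 + axis v 1 \<in> Q"
      by (auto simp: face_def plane_def weight_axis axis_nth_other axis_nth_nonneg)
  qed
  then show "convex hull ?W \<subseteq> Q" by (rule hull_minimal) (rule convex_face)
  have ext: "{x. x extreme_point_of Q} \<subseteq> ?W"
  proof clarify
    fix x assume ext: "x extreme_point_of Q"
    then have xQ: "x \<in> Q" by (simp add: extreme_point_of_def)
    from ext have "{x} face_of Q" by (simp add: face_of_singleton)
    then obtain y where y: "y \<in> Q" "{x} = face (supp y) (tight y)" using faces_of_Q by blast
    have "y = x" using supp_tight_mem(3)[OF y(1)] y(2) by auto
    then have "aff_dim (face (supp x) (tight x)) = 0" using y(2) by (metis aff_dim_sing)
    then have c: "(if tight x = {} then int (card (supp x)) - 1 else int (card (supp x)) - 2) = 0"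
      using aff_dim_face[OF xQ] by simp
    define p where "p v = (THE j. j \<in> J \<and> v \<in> P j)" for v
    have "hits (supp x) \<subseteq> p ` supp x"
    proof
      fix j assume "j \<in> hits (supp x)"
      then obtain v where "v \<in> supp x" "j \<in> J" "v \<in> P j" by (auto simp: hits_def)
      moreover from this have "p v = j" unfolding p_def using part_unique by blast
      ultimately show "j \<in> p ` supp x" by blast
    qed
    then have "card (hits (supp x)) \<le> card (supp x)"
      by (meson card_image_le card_mono finite finite_imageI le_trans)
    \<comment> \<open>Dimension 0 bounds the support size by 2, hence at most two parts are hit.
      This excludes the types with at least three hit parts.\<close>
    then have "card (supp x) = 2" "card (hits (supp x)) = 2" "tight x = hits (supp x)"
      using c type_of_point[OF xQ] by (auto simp: types_def split: if_splits)
    then obtain u v j l where uv: "supp x = {u, v}" "u \<noteq> v"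
      and jl: "hits (supp x) = {j, l}" "j \<noteq> l" "tight x = {j, l}"
      by (metis card_2_iff)
    have J: "j \<in> J" "l \<in> J" using jl by (auto simp: hits_def)
    have zero: "x $ a = 0" if "a \<notin> {u, v}" for a using that uv by (auto simp: supp_def)
    have one: "\<exists>a\<in>{u, v}. a \<in> P i" if "i \<in> {j, l}" for i
      using that jl(1) uv(1) by (auto simp: hits_def)
    \<comment> \<open>New names \<open>a\<close> and \<open>b\<close> are used because it is not
      known which of \<open>u\<close> and \<open>v\<close> lies in \<open>P j\<close>. Each tight
      part meets the support in one element, so that coordinate is 1.\<close>
    have *: "x = axis a 1 + axis b 1" if ab: "{a, b} = {u, v}" "a \<in> P j" "b \<in> P l" for a b
    proof -
      have nb: "b \<notin> P j" "a \<notin> P l" "a \<noteq> b" using ab J jl(2) part_unique by blast+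
      have zero': "x $ c = 0" if "c \<noteq> a" "c \<noteq> b" for c using that ab(1) by (intro zero) blast
      have "\<forall>c\<in>P j - {a}. x $ c = 0" "\<forall>c\<in>P l - {b}. x $ c = 0" using nb zero' by (metis DiffE insertI1)+
      have "weight x (P j) = (\<Sum>c\<in>{a}. x $ c)"
        unfolding weight_def using ab \<open>\<forall>c\<in>P j - {a}. x $ c = 0\<close> by (intro sum.mono_neutral_right) auto
      moreover have "weight x (P l) = (\<Sum>c\<in>{b}. x $ c)"
        unfolding weight_def using ab \<open>\<forall>c\<in>P l - {b}. x $ c = 0\<close> by (intro sum.mono_neutral_right) auto
      moreover have "weight x (P j) = 1" "weight x (P l) = 1" using jl(3) by (auto simp: tight_def)
      ultimately show ?thesis
        using ab nb zero' by (auto simp: vec_eq_iff axis_def)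
    qed
    obtain a b where "a \<in> {u, v}" "a \<in> P j" "b \<in> {u, v}" "b \<in> P l" using one by blast
    moreover from this have "a \<noteq> b" using J jl(2) part_unique by blast
    ultimately show "\<exists>a b. x = axis a 1 + axis b 1 \<and>
        (\<exists>j\<in>J. \<exists>l\<in>J. j \<noteq> l \<and> a \<in> P j \<and> b \<in> P l)"
      using *[of a b] J jl(2) by blast
  qed
  show "Q \<subseteq> convex hull ?W"
    by (rule subset_trans[OF equalityD1[OF Krein_Milman_Minkowski[OF compact_Q convex_face]] hull_mono[OF ext]])
qed

end

section \<open>Counting the faces\<close>

context partition
begin

definition pairs :: "('i \<times> 'i) set" where
  "pairs = {(j, l). j \<in> J \<and> l \<in> J \<and> j < l}"

lemma finite_pairs: "finite pairs"
  by (rule finite_subset[of _ "J \<times> J"]) (auto simp: pairs_def finite_index)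

text \<open>Used with \<open>T = hits S\<close>. A singleton can be completed by any other index, a
  two-element set is itself the only pair, and a larger set fits into none.\<close>

lemma card_pairs_containing:
  assumes "T \<subseteq> J" "T \<noteq> {}"
  shows "int (card {(j, l) \<in> pairs. T \<subseteq> {j, l}}) =
    (if card T = 1 then int (card J) - 1 else if card T = 2 then 1 else 0)"
proof -
  have "finite T" using assms(1) finite_index finite_subset by blast
  then have "0 < card T" using assms(2) by (simp add: card_gt_0_iff)
  then consider "card T = 1" | "card T = 2" | "3 \<le> card T" by linarith
  then show ?thesis
  proof cases
    case 1
    then obtain a where a: "T = {a}" by (auto simp: card_1_singleton_iff)
    \<comment> \<open>The given index \<open>a\<close> is the smaller member of a pair for partners
      in \<open>?U\<close> and the larger one for partners in \<open>?D\<close>.\<close>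
    let ?U = "{l \<in> J. a < l}" and ?D = "{j \<in> J. j < a}"
    have "{(j, l) \<in> pairs. T \<subseteq> {j, l}} = Pair a ` ?U \<union> (\<lambda>j. (j, a)) ` ?D"
      using a assms(1) by (auto simp: pairs_def)
    also have "card \<dots> = card (Pair a ` ?U) + card ((\<lambda>j. (j, a)) ` ?D)"
      using finite_index by (intro card_Un_disjoint) auto
    also have "\<dots> = card ?U + card ?D"
      by (simp add: card_image inj_on_def)
    also have "\<dots> = card (?U \<union> ?D)"
      using finite_index by (intro card_Un_disjoint[symmetric]) auto
    also have "?U \<union> ?D = J - {a}" by auto
    finally have "card {(j, l) \<in> pairs. T \<subseteq> {j, l}} = card (J - {a})" .
    moreover have "card J = Suc (card (J - {a}))"
      using a assms(1) finite_index by (intro card.remove) auto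
    ultimately show ?thesis using 1 by simp
  next
    case 2
    then obtain a b where ab: "T = {a, b}" "a \<noteq> b" by (metis card_2_iff)
    have "{(j, l) \<in> pairs. T \<subseteq> {j, l}} = {(min a b, max a b)}"
      using ab assms(1) by (auto simp: pairs_def min_def max_def)
    then show ?thesis using 2 by simp
  next
    case 3
    have "\<not> T \<subseteq> {j, l}" for j l
      using card_mono[of "{j, l}" T] card_insert_le_m1[of 2 "{l}" j] 3 by auto
    then have "{(j, l) \<in> pairs. T \<subseteq> {j, l}} = {}" by auto
    with 3 show ?thesis by (simp only: card.empty) simp
  qed
qed

abbreviation contained :: "'a set \<Rightarrow> 'a set \<Rightarrow> int" where
  "contained S X \<equiv> (if S \<subseteq> X then 1 else 0)"

text \<open>A union of parts contains \<open>S\<close> iff its index set contains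
  \<open>hits S\<close>, and \<open>S\<close> avoids \<open>P j\<close> iff \<open>j\<close> is not
  hit. All three sums thus depend on \<open>S\<close> only through \<open>card (hits S)\<close>,
  which reduces the counting identities to a case check.\<close>

lemma count_contained:
  assumes S: "S \<subseteq> V" "S \<noteq> {}"
  shows "(\<Sum>(j, l)\<in>pairs. contained S (P j \<union> P l)) =
      (if card (hits S) = 1 then int (card J) - 1 else if card (hits S) = 2 then 1 else 0)"
    and "(\<Sum>j\<in>J. contained S (P j)) = (if card (hits S) = 1 then 1 else 0)"
    and "(\<Sum>j\<in>J. contained S (V - P j)) = int (card J) - int (card (hits S))"
    and "0 < card (hits S)"
proof -
  have sub: "S \<subseteq> (\<Union>j\<in>T. P j) \<longleftrightarrow> hits S \<subseteq> T" if "T \<subseteq> J" for T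
  proof
    assume "S \<subseteq> (\<Union>j\<in>T. P j)"
    then show "hits S \<subseteq> T" using that part_unique by (fastforce simp: hits_def)
  next
    assume "hits S \<subseteq> T"
    then show "S \<subseteq> (\<Union>j\<in>T. P j)" using S(1) by (fastforce simp: hits_def V_def)
  qed
  have hits: "hits S \<subseteq> J" "hits S \<noteq> {}" using S by (auto simp: hits_def V_def)
  then show "0 < card (hits S)" by (simp add: card_gt_0_iff)
  have "(\<Sum>(j, l)\<in>pairs. contained S (P j \<union> P l)) = (\<Sum>z\<in>pairs. if z \<in> {(j, l). hits S \<subseteq> {j, l}} then 1 else 0)"
  proof (intro sum.cong refl)
    fix z assume "z \<in> pairs"
    then obtain j l where z: "z = (j, l)" "j \<in> J" "l \<in> J" by (auto simp: pairs_def)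
    then have "S \<subseteq> P j \<union> P l \<longleftrightarrow> hits S \<subseteq> {j, l}" using sub[of "{j, l}"] by simp
    then show "(case z of (j, l) \<Rightarrow> contained S (P j \<union> P l)) = (if z \<in> {(j, l). hits S \<subseteq> {j, l}} then 1 else 0)"
      by (simp add: z)
  qed
  also have "\<dots> = int (card {(j, l) \<in> pairs. hits S \<subseteq> {j, l}})"
    using finite_pairs by (simp add: sum.If_cases Int_def case_prod_unfold)
  finally show "(\<Sum>(j, l)\<in>pairs. contained S (P j \<union> P l)) =
      (if card (hits S) = 1 then int (card J) - 1 else if card (hits S) = 2 then 1 else 0)"
    using card_pairs_containing[OF hits] by simp
  have "(\<Sum>j\<in>J. contained S (P j)) = (\<Sum>j\<in>J. if hits S = {j} then 1 else 0)"
    using sub[of "{_}"] hits(2) by (intro sum.cong refl if_cong) auto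
  also have "\<dots> = (if card (hits S) = 1 then 1 else 0)"
  proof (cases "card (hits S) = 1")
    case True
    then obtain a where "hits S = {a}" by (auto simp: card_1_singleton_iff)
    then show ?thesis using hits(1) finite_index by simp
  qed (auto intro!: sum.neutral)
  finally show "(\<Sum>j\<in>J. contained S (P j)) = (if card (hits S) = 1 then 1 else 0)" .
  have "(\<Sum>j\<in>J. contained S (V - P j)) = (\<Sum>j\<in>J. if j \<in> J - hits S then 1 else 0)"
    using S(1) by (intro sum.cong refl if_cong) (auto simp: hits_def)
  also have "\<dots> = int (card (J - hits S))"
    using finite_index by (simp add: sum.If_cases set_diff_eq Int_def)
  also have "\<dots> = int (card J) - int (card (hits S))"
    using hits(1) finite_index by (simp add: card_Diff_subset of_nat_diff card_mono)
  finally show "(\<Sum>j\<in>J. contained S (V - P j)) = int (card J) - int (card (hits S))" .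
qed

section \<open>Summation over the supports of a fixed size\<close>

definition subsets :: "nat \<Rightarrow> 'a set set" where
  "subsets k = {S. S \<subseteq> V \<and> card S = k}"

lemma sum_contained:
  assumes "X \<subseteq> V"
  shows "(\<Sum>S\<in>subsets k. contained S X) = int (card X choose k)"
proof -
  have "(\<Sum>S\<in>subsets k. contained S X) = int (card {S. S \<subseteq> X \<and> card S = k})"
    using assms by (simp add: sum.If_cases subsets_def Int_def) (meson subset_trans)
  then show ?thesis by (simp add: n_subsets)
qed

lemma part_subset: "j \<in> J \<Longrightarrow> P j \<subseteq> V"
  by (auto simp: V_def)

text \<open>After exchanging the sums, each inner sum counts the \<open>k\<close>-subsets of a union
  of two disjoint parts.\<close>

lemma sum_subsets_pairs:
  "(\<Sum>S\<in>subsets k. \<Sum>(j, l)\<in>pairs. contained S (P j \<union> P l)) =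
    (\<Sum>(j, l)\<in>pairs. int ((card (P j) + card (P l)) choose k))"
proof -
  have "(\<Sum>S\<in>subsets k. \<Sum>(j, l)\<in>pairs. contained S (P j \<union> P l)) =
      (\<Sum>(j, l)\<in>pairs. \<Sum>S\<in>subsets k. contained S (P j \<union> P l))"
    unfolding case_prod_unfold by (rule sum.swap)
  also have "\<dots> = (\<Sum>(j, l)\<in>pairs. int ((card (P j) + card (P l)) choose k))"
  proof (intro sum.cong refl, clarify)
    fix j l assume "(j, l) \<in> pairs"
    then have jl: "j \<in> J" "l \<in> J" "j \<noteq> l" by (auto simp: pairs_def)
    then have "P j \<inter> P l = {}" using part_unique by blast
    then show "(\<Sum>S\<in>subsets k. contained S (P j \<union> P l)) = int ((card (P j) + card (P l)) choose k)"
      using jl by (simp add: sum_contained part_subset card_Un_disjoint)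
  qed
  finally show ?thesis .
qed

lemma sum_subsets_parts:
  "(\<Sum>S\<in>subsets k. \<Sum>j\<in>J. contained S (P j)) = (\<Sum>j\<in>J. int (card (P j) choose k))"
  by (subst sum.swap) (simp add: sum_contained part_subset)

lemma sum_subsets_complements:
  "(\<Sum>S\<in>subsets k. \<Sum>j\<in>J. contained S (V - P j)) = (\<Sum>j\<in>J. int ((card V - card (P j)) choose k))"
  by (subst sum.swap) (simp add: sum_contained part_subset card_Diff_subset)

lemma card_subsets: "card (subsets k) = card V choose k"
  by (simp add: subsets_def n_subsets)

text \<open>The identity for \<open>[t >= 3]\<close>, summed over all supports of size
  \<open>k\<close>; \<open>0 < k\<close> makes these nonempty, as the identity requires.\<close>

lemma card_many_hits:
  assumes "0 < k"
  shows "int (card {S \<in> subsets k. 3 \<le> card (hits S)}) =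
    int (card V choose k) - (\<Sum>(j, l)\<in>pairs. int ((card (P j) + card (P l)) choose k))
      + (int (card J) - 2) * (\<Sum>j\<in>J. int (card (P j) choose k))"
proof -
  have "int (card {S \<in> subsets k. 3 \<le> card (hits S)}) = (\<Sum>S\<in>subsets k. if 3 \<le> card (hits S) then 1 else 0)"
    by (simp add: sum.If_cases Int_def)
  also have "\<dots> = (\<Sum>S\<in>subsets k. 1 - (\<Sum>(j, l)\<in>pairs. contained S (P j \<union> P l)) +
      (int (card J) - 2) * (\<Sum>j\<in>J. contained S (P j)))"
  proof (intro sum.cong refl)
    fix S assume "S \<in> subsets k"
    then have S: "S \<subseteq> V" "S \<noteq> {}" using assms by (auto simp: subsets_def)
    show "(if 3 \<le> card (hits S) then 1 else 0) = 1 - (\<Sum>(j, l)\<in>pairs. contained S (P j \<union> P l)) +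
      (int (card J) - 2) * (\<Sum>j\<in>J. contained S (P j))"
      unfolding count_contained(1,2)[OF S] using count_contained(4)[OF S] by auto
  qed
  also have "\<dots> = int (card V choose k) - (\<Sum>(j, l)\<in>pairs. int ((card (P j) + card (P l)) choose k))
      + (int (card J) - 2) * (\<Sum>j\<in>J. int (card (P j) choose k))"
    by (simp add: sum.distrib sum_subtractf sum_distrib_left[symmetric] sum_subsets_pairs
        sum_subsets_parts card_subsets)
  finally show ?thesis .
qed

text \<open>A support hitting \<open>t\<close> parts admits \<open>t\<close> nonempty tight sets if
  \<open>t >= 3\<close>, one if \<open>t = 2\<close> and none otherwise. The second counting
  identity expresses this number and is summed over the supports.\<close>

lemma card_tight_types:
  assumes "0 < k"
  shows "int (card (SIGMA S:subsets k. {T. T \<noteq> {} \<and> (S, T) \<in> types})) =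
    int (card J) * int (card V choose k) - (\<Sum>j\<in>J. int ((card V - card (P j)) choose k))
      + (int (card J) - 2) * (\<Sum>j\<in>J. int (card (P j) choose k))
      - (\<Sum>(j, l)\<in>pairs. int ((card (P j) + card (P l)) choose k))"
proof -
  have fin: "finite {T. T \<noteq> {} \<and> (S, T) \<in> types}" for S
    by (rule finite_subset[of _ "Pow (hits S)"]) (auto simp: types_def)
  have "int (card (SIGMA S:subsets k. {T. T \<noteq> {} \<and> (S, T) \<in> types})) =
      (\<Sum>S\<in>subsets k. int (card {T. T \<noteq> {} \<and> (S, T) \<in> types}))"
    by (subst card_SigmaI) (auto simp: fin)
  also have "\<dots> = (\<Sum>S\<in>subsets k. int (card J) - (\<Sum>j\<in>J. contained S (V - P j)) +
      (int (card J) - 2) * (\<Sum>j\<in>J. contained S (P j)) -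
      (\<Sum>(j, l)\<in>pairs. contained S (P j \<union> P l)))"
  proof (intro sum.cong refl)
    fix S assume "S \<in> subsets k"
    then have S: "S \<subseteq> V" "S \<noteq> {}" using assms by (auto simp: subsets_def)
    have "card {T. T \<noteq> {} \<and> (S, T) \<in> types} =
      (if 3 \<le> card (hits S) then card (hits S) else if card (hits S) = 2 then 1 else 0)"
    proof -
      consider "3 \<le> card (hits S)" | "card (hits S) = 2" | "card (hits S) < 2" by linarith
      then show ?thesis
      proof cases
        case 1
        then have "{T. T \<noteq> {} \<and> (S, T) \<in> types} = (\<lambda>j. {j}) ` hits S" using S by (auto simp: types_def)
        then show ?thesis using 1 by (simp add: card_image)
      next
        case 2
        then have "{T. T \<noteq> {} \<and> (S, T) \<in> types} = {hits S}" using S by (auto simp: types_def)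
        then show ?thesis using 2 by simp
      next
        case 3
        then have "{T. T \<noteq> {} \<and> (S, T) \<in> types} = {}" by (auto simp: types_def)
        with 3 show ?thesis by (simp only: card.empty) simp
      qed
    qed
    then show "int (card {T. T \<noteq> {} \<and> (S, T) \<in> types}) =
      int (card J) - (\<Sum>j\<in>J. contained S (V - P j)) +
      (int (card J) - 2) * (\<Sum>j\<in>J. contained S (P j)) - (\<Sum>(j, l)\<in>pairs. contained S (P j \<union> P l))"
      unfolding count_contained(1-3)[OF S] using count_contained(4)[OF S] by auto
  qed
  also have "\<dots> = int (card J) * int (card V choose k) - (\<Sum>j\<in>J. int ((card V - card (P j)) choose k))
      + (int (card J) - 2) * (\<Sum>j\<in>J. int (card (P j) choose k))
      - (\<Sum>(j, l)\<in>pairs. int ((card (P j) + card (P l)) choose k))"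
    by (simp add: sum.distrib sum_subtractf sum_distrib_left[symmetric] sum_subsets_pairs
        sum_subsets_parts sum_subsets_complements card_subsets)
  finally show ?thesis .
qed

text \<open>Faces of dimension \<open>i\<close> have support size \<open>i + 1\<close> if no part is
  tight and \<open>i + 2\<close> otherwise. The two counts are added.\<close>

lemma num_faces_formula:
  "int (num_faces Q i) =
    int ((card V + 1) choose (i + 2)) + (int (card J) - 1) * int (card V choose (i + 2))
    - (\<Sum>(j, l)\<in>pairs. int ((card (P j) + card (P l) + 1) choose (i + 2)))
    + (int (card J) - 2) * (\<Sum>j\<in>J. int ((card (P j) + 1) choose (i + 2)))
    - (\<Sum>j\<in>J. int ((card V - card (P j)) choose (i + 2)))"
proof -
  let ?A = "{S \<in> subsets (i + 1). 3 \<le> card (hits S)} \<times> {{} :: 'i set}"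
  let ?B = "SIGMA S:subsets (i + 2). {T. T \<noteq> {} \<and> (S, T) \<in> types}"
  have "{(S, T) \<in> types. card S = (if T = {} then i + 1 else i + 2)} = ?A \<union> ?B"
    by (auto simp: types_def subsets_def split: if_splits)
  moreover have "card (?A \<union> ?B) = card ?A + card ?B"
  proof (rule card_Un_disjoint)
    \<comment> \<open>The index type may be infinite, so finiteness comes from the tight sets lying
      in \<open>J\<close>.\<close>
    have "?B \<subseteq> UNIV \<times> Pow J" by (auto simp: types_def hits_def)
    then show "finite ?B" by (rule finite_subset) (simp add: finite_index)
  qed auto
  ultimately have "int (num_faces Q i) = int (card {S \<in> subsets (i + 1). 3 \<le> card (hits S)}) + int (card ?B)"
    by (simp add: num_faces_Q card_cartesian_product)
  also have "\<dots> = int ((card V + 1) choose (i + 2)) + (int (card J) - 1) * int (card V choose (i + 2))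
    - (\<Sum>(j, l)\<in>pairs. int ((card (P j) + card (P l) + 1) choose (i + 2)))
    + (int (card J) - 2) * (\<Sum>j\<in>J. int ((card (P j) + 1) choose (i + 2)))
    - (\<Sum>j\<in>J. int ((card V - card (P j)) choose (i + 2)))"
  proof -
    \<comment> \<open>Binomials with lower index \<open>i + 1\<close> from the first count pair up
      with those of lower index \<open>i + 2\<close> from the second. One of the
      \<open>card J\<close> copies of \<open>card V choose (i + 2)\<close> is absorbed, which leaves
      the factor \<open>card J - 1\<close>.\<close>
    have pascal: "int ((m + 1) choose (i + 2)) = int (m choose (i + 1)) + int (m choose (i + 2))" for m
      by simp
    show ?thesis
      by (subst card_many_hits, simp, subst card_tight_types, simp)
         (simp only: pascal sum.distrib case_prod_unfold, simp only: algebra_simps)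
  qed
  finally show ?thesis .
qed

end

section \<open>Loopless matroids of rank two\<close>

context matroid
begin

lemma finite_indep: "finite I"
  using indep_subset_ground finite_ground by (meson finite_Pow_iff finite_subset PowI subsetI)

lemma card_le_rank: "X \<in> I \<Longrightarrow> X \<subseteq> Y \<Longrightarrow> card X \<le> matroid_rank I Y"
  unfolding matroid_rank_def using finite_indep by (intro Max_ge) auto

lemma rank_attained: "\<exists>X\<in>I. X \<subseteq> Y \<and> card X = matroid_rank I Y"
proof -
  have "matroid_rank I Y \<in> {card X | X. X \<in> I \<and> X \<subseteq> Y}"
    unfolding matroid_rank_def using finite_indep empty_indep by (intro Max_in) auto
  then show ?thesis by auto
qed

lemma rank_mono: "X \<subseteq> Y \<Longrightarrow> matroid_rank I X \<le> matroid_rank I Y"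
  using rank_attained[of X] card_le_rank by (metis subset_trans)

end

locale loopless_rank_two = matroid +
  assumes loopless: "loopless E I" and rank_two: "matroid_rank I E = 2"
begin

section \<open>Hyperplanes as parallel classes\<close>

lemma card_indep_le: "X \<in> I \<Longrightarrow> card X \<le> 2"
  using card_le_rank[OF _ indep_subset_ground] rank_two by metis

text \<open>Looplessness gives a nonempty set rank at least 1, and rank at least 2 would yield an
  independent pair by passing to a subset.\<close>

lemma rank_one_iff:
  assumes "F \<subseteq> E"
  shows "matroid_rank I F = 1 \<longleftrightarrow> F \<noteq> {} \<and> (\<forall>u\<in>F. \<forall>v\<in>F. u \<noteq> v \<longrightarrow> {u, v} \<notin> I)"
proof
  assume r: "matroid_rank I F = 1"
  have "F \<noteq> {}" using rank_attained[of F] r by auto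
  moreover have "{u, v} \<notin> I" if "u \<in> F" "v \<in> F" "u \<noteq> v" for u v
    using card_le_rank[of "{u, v}" F] that r by auto
  ultimately show "F \<noteq> {} \<and> (\<forall>u\<in>F. \<forall>v\<in>F. u \<noteq> v \<longrightarrow> {u, v} \<notin> I)" by blast
next
  assume r: "F \<noteq> {} \<and> (\<forall>u\<in>F. \<forall>v\<in>F. u \<noteq> v \<longrightarrow> {u, v} \<notin> I)"
  then obtain u where "u \<in> F" by auto
  then have "1 \<le> matroid_rank I F"
    using card_le_rank[of "{u}" F] loopless assms by (auto simp: loopless_def)
  moreover obtain X where X: "X \<in> I" "X \<subseteq> F" "card X = matroid_rank I F"
    using rank_attained by blast
  have "\<not> 2 \<le> card X"
  proof
    assume "2 \<le> card X"
    then obtain Y where "Y \<subseteq> X" "card Y = 2" by (meson obtain_subset_with_card_n)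
    then obtain a b where "{a, b} \<subseteq> X" "a \<noteq> b" by (metis card_2_iff)
    then show False using X r indep_downward by blast
  qed
  ultimately show "matroid_rank I F = 1" using X(3) by linarith
qed

text \<open>The case \<open>y = x\<close> is listed separately because \<open>{x, x}\<close> is a
  singleton, which is independent in a loopless matroid.\<close>

definition parallel_class :: "'a \<Rightarrow> 'a set" where
  "parallel_class x = {y \<in> E. y = x \<or> {x, y} \<notin> I}"

text \<open>Were \<open>{y, z}\<close> independent, augmenting \<open>{x}\<close> from it would make
  \<open>x\<close> independent with \<open>y\<close> or with \<open>z\<close>.\<close>

lemma parallel_trans:
  assumes "x \<in> E" "y \<in> parallel_class x" "z \<in> parallel_class x" "y \<noteq> z"
  shows "{y, z} \<notin> I"
proof
  assume "{y, z} \<in> I"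
  moreover have "{x} \<in> I" using assms(1) loopless by (simp add: loopless_def)
  ultimately obtain w where "w \<in> {y, z} - {x}" "{w, x} \<in> I"
    using augmentation[of "{x}" "{y, z}"] assms(4) by auto
  then show False using assms(2,3) by (auto simp: parallel_class_def insert_commute)
qed

text \<open>A rank one flat through \<open>x\<close> has no independent pair, so it lies in the
  class of \<open>x\<close>; a missing element of the class could be added without raising the rank,
  against flatness. Conversely, a class has rank 1 by transitivity, and any outside element forms an
  independent pair with \<open>x\<close>.\<close>

lemma hyperplanes_eq: "matroid_hyperplanes E I = parallel_class ` E"
proof (intro subset_antisym subsetI)
  have rank_class: "matroid_rank I (parallel_class x) = 1" if "x \<in> E" for x
    using that parallel_trans[OF that] by (subst rank_one_iff) (auto simp: parallel_class_def)
  {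
    fix F assume "F \<in> matroid_hyperplanes E I"
    then have F: "F \<subseteq> E" "matroid_rank I F = 1"
      and flat: "\<And>y. y \<in> E - F \<Longrightarrow> 1 < matroid_rank I (insert y F)"
      using rank_two by (auto simp: matroid_hyperplanes_def matroid_flat_def)
    then have F1: "F \<noteq> {}" "\<And>u v. u \<in> F \<Longrightarrow> v \<in> F \<Longrightarrow> u \<noteq> v \<Longrightarrow> {u, v} \<notin> I"
      using rank_one_iff[OF F(1)] by auto
    then obtain x where x: "x \<in> F" by auto
    then have sub: "F \<subseteq> parallel_class x"
      using F(1) F1(2) by (auto simp: parallel_class_def)
    moreover have "y \<in> F" if y: "y \<in> parallel_class x" for y
    proof (rule ccontr)
      assume "y \<notin> F"
      then have "1 < matroid_rank I (insert y F)" using flat y by (auto simp: parallel_class_def)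
      moreover have "matroid_rank I (insert y F) \<le> 1"
        using rank_mono[of "insert y F" "parallel_class x"] sub y rank_class[of x] x F(1) by auto
      ultimately show False by simp
    qed
    ultimately show "F \<in> parallel_class ` E" using x F(1) by auto
  next
    fix F assume "F \<in> parallel_class ` E"
    then obtain x where x: "x \<in> E" "F = parallel_class x" by blast
    have "1 < matroid_rank I (insert z F)" if z: "z \<in> E - F" for z
    proof -
      have "{x, z} \<in> I" "x \<noteq> z" "{x, z} \<subseteq> insert z F" using z x by (auto simp: parallel_class_def)
      then show ?thesis using card_le_rank[of "{x, z}" "insert z F"] by auto
    qed
    then show "F \<in> matroid_hyperplanes E I"
      using rank_class[OF x(1)] x rank_two
      by (auto simp: matroid_hyperplanes_def matroid_flat_def parallel_class_def)
  }
qed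

lemma parallel_class_eq:
  assumes "x \<in> E" "z \<in> parallel_class x"
  shows "parallel_class z = parallel_class x"
proof -
  have z: "z \<in> E" "x \<in> parallel_class z"
    using assms by (auto simp: parallel_class_def insert_commute)
  have "parallel_class a \<subseteq> parallel_class b" if "a \<in> E" "b \<in> parallel_class a" for a b
    using parallel_trans[OF that] by (auto simp: parallel_class_def)
  then show ?thesis using assms z by blast
qed

lemma Union_hyperplanes: "\<Union> (matroid_hyperplanes E I) = E"
  unfolding hyperplanes_eq by (auto simp: parallel_class_def)

lemma hyperplanes_disjoint:
  assumes "F \<in> matroid_hyperplanes E I" "G \<in> matroid_hyperplanes E I" "F \<noteq> G"
  shows "F \<inter> G = {}"
  using assms parallel_class_eq unfolding hyperplanes_eq by blast

text \<open>This identifies the independent pairs with the edges of the complete multipartite graph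
  on the hyperplanes: \<open>{u, v}\<close> is independent iff \<open>v\<close> lies outside the
  parallel class of \<open>u\<close>.\<close>

lemma indep_pair_iff:
  "u \<noteq> v \<and> {u, v} \<in> I \<longleftrightarrow>
    (\<exists>F\<in>matroid_hyperplanes E I. \<exists>G\<in>matroid_hyperplanes E I. F \<noteq> G \<and> u \<in> F \<and> v \<in> G)"
proof
  assume uv: "u \<noteq> v \<and> {u, v} \<in> I"
  then have "u \<in> E" "v \<in> E" using indep_subset_ground by auto
  moreover have "u \<in> parallel_class u" "v \<in> parallel_class v" "v \<notin> parallel_class u"
    using uv calculation by (auto simp: parallel_class_def)
  ultimately show "\<exists>F\<in>matroid_hyperplanes E I. \<exists>G\<in>matroid_hyperplanes E I. F \<noteq> G \<and> u \<in> F \<and> v \<in> G"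
    unfolding hyperplanes_eq by (metis imageI)
next
  assume "\<exists>F\<in>matroid_hyperplanes E I. \<exists>G\<in>matroid_hyperplanes E I. F \<noteq> G \<and> u \<in> F \<and> v \<in> G"
  then obtain F G where FG: "F \<in> matroid_hyperplanes E I" "G \<in> matroid_hyperplanes E I"
    "F \<noteq> G" "u \<in> F" "v \<in> G" by blast
  then have "v \<notin> F" using hyperplanes_disjoint by blast
  moreover have "F = parallel_class u" "v \<in> E"
    using FG parallel_class_eq Union_hyperplanes unfolding hyperplanes_eq by blast+
  ultimately show "u \<noteq> v \<and> {u, v} \<in> I" using FG(4) by (auto simp: parallel_class_def)
qed

text \<open>An independent set with fewer than two elements can be augmented from an independent
  pair, so it is not maximal; rank two makes every independent pair maximal.\<close>

lemma bases_eq: "matroid_bases I = {{u, v} | u v. u \<noteq> v \<and> {u, v} \<in> I}"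
proof (intro subset_antisym subsetI)
  fix B assume B: "B \<in> matroid_bases I"
  then have BI: "B \<in> I" by (simp add: matroid_bases_def)
  obtain X where X: "X \<in> I" "card X = 2" using rank_attained[of E] rank_two by auto
  have "\<not> card B < 2"
    using augmentation[OF BI X(1)] X(2) B by (auto simp: matroid_bases_def)
  then have "card B = 2" using card_indep_le[OF BI] by simp
  then show "B \<in> {{u, v} | u v. u \<noteq> v \<and> {u, v} \<in> I}" using BI by (auto simp: card_2_iff)
next
  fix B assume "B \<in> {{u, v} | u v. u \<noteq> v \<and> {u, v} \<in> I}"
  then have B: "B \<in> I" "card B = 2" by auto
  have "X = B" if "X \<in> I" "B \<subseteq> X" for X
  proof -
    have "finite X" using indep_subset_ground[OF that(1)] finite_ground finite_subset by blast
    then show ?thesis using card_seteq[of X B] card_indep_le[OF that(1)] B that by auto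
  qed
  then show "B \<in> matroid_bases I" using B by (auto simp: matroid_bases_def)
qed

end

section \<open>Transfer to base polytopes and edge polytopes\<close>

lemma indicator_doubleton:
  "u \<noteq> v \<Longrightarrow> (\<chi> x. indicator {u, v} x) = axis u 1 + (axis v 1 :: real ^ 'a::finite)"
  by (auto simp: vec_eq_iff axis_def indicator_def)

lemma base_polytope_eq:
  fixes I :: "'a::finite set set"
  assumes "loopless_rank_two E I"
  shows "base_polytope I = convex hull {axis u 1 + axis v 1 | u v. u \<noteq> v \<and> {u, v} \<in> I}"
proof -
  interpret loopless_rank_two E I by fact
  have "(\<lambda>B. (\<chi> x. indicator B x) :: real ^ 'a) ` matroid_bases I =
      {(\<chi> x. indicator {u, v} x) | u v. u \<noteq> v \<and> {u, v} \<in> I}"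
    unfolding bases_eq by blast
  also have "\<dots> = {axis u 1 + axis v 1 | u v. u \<noteq> v \<and> {u, v} \<in> I}"
    by (intro Collect_cong iff_exI) (auto simp: indicator_doubleton)
  finally show ?thesis by (simp add: base_polytope_def)
qed

text \<open>The adjacency relation is left abstract so that both independent pairs of the matroid
  and edges of a graph can be inserted; by \<open>W\<close> the hull is \<open>Q\<close>.\<close>

lemma num_faces_multipartite_hull:
  fixes P :: "nat \<Rightarrow> 'a::finite set"
  assumes disj: "disjoint_family_on P {1..s}"
    and n: "card (\<Union>j\<in>{1..s}. P j) = n" and h: "\<And>j. j \<in> {1..s} \<Longrightarrow> card (P j) = h j"
    and W: "\<And>u v. adj u v \<longleftrightarrow> (\<exists>j\<in>{1..s}. \<exists>l\<in>{1..s}. j \<noteq> l \<and> u \<in> P j \<and> v \<in> P l)"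
  shows "int (num_faces (convex hull {axis u 1 + axis v 1 :: real ^ 'a | u v. adj u v}) i) =
    rank_two_face_number n s h i"
proof -
  interpret partition "{1..s}" P using disj by unfold_locales auto
  have pairs: "pairs = {(j, l). 1 \<le> j \<and> j < l \<and> l \<le> s}" unfolding pairs_def by auto
  have "int (num_faces Q i) = int ((n + 1) choose (i + 2)) + (int s - 1) * int (n choose (i + 2))
    - (\<Sum>(j, l)\<in>pairs. int ((h j + h l + 1) choose (i + 2)))
    + (int s - 2) * (\<Sum>j = 1..s. int ((h j + 1) choose (i + 2)))
    - (\<Sum>j = 1..s. int ((n - h j) choose (i + 2)))"
  proof -
    have "(\<Sum>(j, l)\<in>pairs. int ((card (P j) + card (P l) + 1) choose (i + 2))) =
        (\<Sum>(j, l)\<in>pairs. int ((h j + h l + 1) choose (i + 2)))"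
      by (intro sum.cong refl) (unfold pairs_def, auto simp: h)
    moreover have "(\<Sum>j = 1..s. int ((card (P j) + 1) choose (i + 2))) = (\<Sum>j = 1..s. int ((h j + 1) choose (i + 2)))"
      "(\<Sum>j = 1..s. int ((n - card (P j)) choose (i + 2))) = (\<Sum>j = 1..s. int ((n - h j) choose (i + 2)))"
      by (intro sum.cong refl; simp add: h)+
    moreover have "card V = n" unfolding V_def by (rule n)
    moreover have "card {1..s} = s" by simp
    ultimately show ?thesis using num_faces_formula[of i] by (simp only:)
  qed
  then show ?thesis unfolding W Q_eq_hull[symmetric] rank_two_face_number_def pairs[symmetric] .
qed

theorem corollary2p12:
  fixes E :: "'a::finite set" and I :: "'a set set"
    and n s :: nat and H :: "nat \<Rightarrow> 'a set" and h :: "nat \<Rightarrow> nat"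
  assumes "matroid E I"
    and "loopless E I"
    and "matroid_rank I E = 2"
    and "card E = n"
    and "bij_betw H {1..s} (matroid_hyperplanes E I)"
    and "\<And>j. j \<in> {1..s} \<Longrightarrow> h j = card (H j)"
  shows "\<forall>i::nat.
    int (num_faces (base_polytope I) i) = rank_two_face_number n s h i \<and>
    (\<forall>(V :: 'b::finite set) D P.
       complete_multipartite V D {1..s} P \<and> (\<forall>j \<in> {1..s}. card (P j) = h j) \<longrightarrow>
       int (num_faces (edge_polytope D) i) = rank_two_face_number n s h i)"
proof (intro allI conjI impI)
  fix i
  interpret loopless_rank_two E I
    using assms(1-3) by (simp add: loopless_rank_two_def loopless_rank_two_axioms_def)
  have hyps: "matroid_hyperplanes E I = H ` {1..s}" and inj: "inj_on H {1..s}"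
    using assms(5) by (auto simp: bij_betw_def)
  have disj: "disjoint_family_on H {1..s}"
    unfolding disjoint_family_on_def using hyperplanes_disjoint hyps inj
    by (metis imageI inj_onD)
  have union: "(\<Union>j\<in>{1..s}. H j) = E" using Union_hyperplanes hyps by simp
  show "int (num_faces (base_polytope I) i) = rank_two_face_number n s h i"
    unfolding base_polytope_eq[OF loopless_rank_two_axioms]
  proof (rule num_faces_multipartite_hull[OF disj])
    show "u \<noteq> v \<and> {u, v} \<in> I \<longleftrightarrow> (\<exists>j\<in>{1..s}. \<exists>l\<in>{1..s}. j \<noteq> l \<and> u \<in> H j \<and> v \<in> H l)" for u v
      \<comment> \<open>Injectivity of \<open>H\<close> converts distinct hyperplanes into distinct
        indices.\<close>
      unfolding indep_pair_iff hyps bex_simps(7) using inj_on_eq_iff[OF inj] by blast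
    show "card (\<Union>j\<in>{1..s}. H j) = n" unfolding union by (rule assms(4))
    show "card (H j) = h j" if "j \<in> {1..s}" for j using assms(6)[OF that] by simp
  qed
  fix V :: "'b set" and D P
  assume "complete_multipartite V D {1..s} P \<and> (\<forall>j\<in>{1..s}. card (P j) = h j)"
  then have P: "disjoint_family_on P {1..s}" "V = (\<Union>j\<in>{1..s}. P j)"
      "D = {{u, v} | u v. \<exists>j\<in>{1..s}. \<exists>l\<in>{1..s}. j \<noteq> l \<and> u \<in> P j \<and> v \<in> P l}"
      "\<And>j. j \<in> {1..s} \<Longrightarrow> card (P j) = h j"
    by (auto simp: complete_multipartite_def)
  \<comment> \<open>The graph shares only the part sizes with the matroid, so its number of vertices
    is recovered as the sum of the \<open>h j\<close>.\<close>
  have "card V = (\<Sum>j\<in>{1..s}. card (P j))"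
    unfolding P(2) using P(1) by (intro card_UN_disjoint) (auto simp: disjoint_family_on_def)
  also have "\<dots> = (\<Sum>j\<in>{1..s}. card (H j))" using P(4) assms(6) by simp
  also have "\<dots> = card (\<Union>j\<in>{1..s}. H j)"
    using disj by (intro card_UN_disjoint[symmetric]) (auto simp: disjoint_family_on_def)
  finally have "card V = n" using union assms(4) by simp
  show "int (num_faces (edge_polytope D) i) = rank_two_face_number n s h i"
    unfolding edge_polytope_def
  proof (rule num_faces_multipartite_hull[OF P(1)])
    show "u \<noteq> v \<and> {u, v} \<in> D \<longleftrightarrow> (\<exists>j\<in>{1..s}. \<exists>l\<in>{1..s}. j \<noteq> l \<and> u \<in> P j \<and> v \<in> P l)"
      (is "_ \<longleftrightarrow> ?adj u v") for u v
    proof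
      assume "u \<noteq> v \<and> {u, v} \<in> D"
      then obtain a b where "{u, v} = {a, b}" "?adj a b" unfolding P(3) by blast
      \<comment> \<open>The edge may be listed with its endpoints exchanged; adjacency is symmetric
        in the two parts.\<close>
      then show "?adj u v" unfolding doubleton_eq_iff by metis
    next
      assume adj: "?adj u v"
      then have "u \<noteq> v" using P(1) by (auto simp: disjoint_family_on_def)
      then show "u \<noteq> v \<and> {u, v} \<in> D" unfolding P(3) using adj by blast
    qed
    show "card (\<Union>j\<in>{1..s}. P j) = n" using \<open>card V = n\<close> P(2) by (simp only:)
  qed (rule P(4))
qed

end
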